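(* Suppose that $\nabla f$ is Lipschitz continuous with constant $L_f>0$, that $h$ is proper, closed and convex, that $F=f+h$ is bounded below, and that $f$ is $\mu$-strongly convex with $\mu>0$. Let $\theta\in(0,1/2)$, $\lambda\in(0,1)$ and $\nu\in(0,1)$ be constants. Let $\{x_k\}_{k\ge0}\subset\mathbb{R}^n$ be a sequence of iterates with $s_k:=x_{k+1}-x_k\neq0$, and let $y^{\mathrm{SS}}_{k-1}:=g^{\mathrm{SS}}_k-g^{\mathrm{SS}}_{k-1}$, where $g^{\mathrm{SS}}_k$ is the spherical smoothing gradient estimate of $f$ at $x_k$ with radius $\Delta_k$ and $N_k$ samples. If for all $k$ $$\Delta_k=\frac{\theta\mu}{\sqrt n\,L_f}\min\{\|s_{k-1}\|,\|s_k\|\},$$ $$\begin{aligned}N_k\ge\Bigg[&\frac{6n}{\mu^2(1-\lambda)^2\left(\frac12-\frac{\theta}{\sqrt n}\right)^2}\left(\frac{\|\nabla f(x_k)\|}{\min\{\|s_{k-1}\|,\|s_k\|\}}\right)^2+\frac{4n}{3\mu(1-\lambda)\left(\frac12-\frac{\theta}{\sqrt n}\right)}\frac{\|\nabla f(x_k)\|}{\min\{\|s_{k-1}\|,\|s_k\|\}}\\&+\frac{2\theta\sqrt n}{3(1-\lambda)\left(\frac12-\frac{\theta}{\sqrt n}\right)^2}+\frac{3\theta^2n}{2(1-\lambda)^2\left(\frac12-\frac{\theta}{\sqrt n}\right)^2}\Bigg]\log\frac{n+1}{\nu},\end{aligned}$$ then $(y^{\mathrm{SS}}_{k-1})^\top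 s_{k-1}>0$ holds with probability at least $1-\nu$ (for each $k\ge1$).
   Context: $f:\mathbb{R}^n\to\mathbb{R}$ is continuously differentiable, $h:\mathbb{R}^n\to\mathbb{R}\cup\{+\infty\}$, and $\|\cdot\|$ is the Euclidean norm. The spherical smoothing estimate is $$g^{\mathrm{SS}}_k:=\frac n{N_k}\sum_{i=1}^{N_k}\frac{f(x_k+\Delta_ku_i)-f(x_k)}{\Delta_k}u_i,$$ where the $u_i$ are independent and uniformly distributed on the unit sphere of $\mathbb{R}^n$ centered at the origin, drawn afresh and independently for each $k$, and $N_k$ is a positive integer. The points $x_k$ are regarded as fixed and the probability is over the random directions. For $k=0$ the minimum is read as $\|s_0\|$. *)

theory Defs
  imports "HOL-Probability.Probability"
begin

subsection \<open>Functions with values in the reals extended by plus infinity\<close>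

definition proper_fun :: "('a \<Rightarrow> ereal) \<Rightarrow> bool" where
  "proper_fun h \<longleftrightarrow> (\<forall>x. h x \<noteq> -\<infinity>) \<and> (\<exists>x. h x \<noteq> \<infinity>)"

definition ereal_epigraph :: "('a \<Rightarrow> ereal) \<Rightarrow> ('a \<times> real) set" where
  "ereal_epigraph h = {(x, t). h x \<le> ereal t}"

definition closed_fun :: "('a::topological_space \<Rightarrow> ereal) \<Rightarrow> bool" where
  "closed_fun h \<longleftrightarrow> closed (ereal_epigraph h)"

definition convex_fun :: "('a::real_vector \<Rightarrow> ereal) \<Rightarrow> bool" where
  "convex_fun h \<longleftrightarrow> convex (ereal_epigraph h)"

definition bounded_below_fun :: "('a \<Rightarrow> ereal) \<Rightarrow> bool" where
  "bounded_below_fun F \<longleftrightarrow> (\<exists>m::real. \<forall>x. ereal m \<le> F x)"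

definition strongly_convex :: "real \<Rightarrow> ('a::real_normed_vector \<Rightarrow> real) \<Rightarrow> bool" where
  "strongly_convex \<mu> f \<longleftrightarrow>
     (\<forall>x y. \<forall>t\<in>{0..1}. f (t *\<^sub>R x + (1 - t) *\<^sub>R y)
        \<le> t * f x + (1 - t) * f y - \<mu> / 2 * t * (1 - t) * (norm (x - y))\<^sup>2)"


subsection \<open>The uniform distribution on the unit sphere\<close>

text \<open>
  The normalised surface measure of a Borel set \<open>A\<close> of unit vectors is the Lebesgue volume of the
  cone \<open>{r a | 0 < r < 1, a \<in> A}\<close> divided by the volume of the unit ball, that is, the image of the
  uniform distribution on the ball under \<open>x \<mapsto> x / \<parallel>x\<parallel>\<close>. The value \<open>sgn 0 = 0\<close> lies off the
  sphere, but it is only taken on a null set. The measure is defined on the Borel sets of the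
  whole space; the lemmas below show that it is a probability measure concentrated on the unit
  sphere and invariant under orthogonal transformations.
\<close>

definition uniform_sphere :: "'a::euclidean_space measure" where
  "uniform_sphere = distr (uniform_measure lborel (ball 0 1)) borel sgn"

lemma sgn_borel_measurable [measurable]:
  "(sgn :: 'a::euclidean_space \<Rightarrow> 'a) \<in> borel_measurable borel"
  unfolding sgn_div_norm by measurable

lemma sets_uniform_sphere [simp, measurable_cong]: "sets uniform_sphere = sets borel"
  by (simp add: uniform_sphere_def)

lemma space_uniform_sphere [simp]: "space uniform_sphere = UNIV"
  by (simp add: uniform_sphere_def)

lemma emeasure_unit_ball:
  "emeasure lborel (ball (0::'a::euclidean_space) 1) \<noteq> 0"
  "emeasure lborel (ball (0::'a::euclidean_space) 1) \<noteq> \<infinity>"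
proof -
  show "emeasure lborel (ball (0::'a) 1) \<noteq> 0"
  proof
    assume "emeasure lborel (ball (0::'a) 1) = 0"
    then have "ball (0::'a) 1 \<in> null_sets lborel" by auto
    then have "negligible (ball (0::'a) 1)"
      by (simp add: negligible_iff_null_sets null_sets_completionI)
    then show False using open_not_negligible[of "ball (0::'a) 1"] by simp
  qed
  show "emeasure lborel (ball (0::'a) 1) \<noteq> \<infinity>"
    using emeasure_bounded_finite[of "ball (0::'a) 1"] by simp
qed

lemma prob_space_uniform_sphere: "prob_space (uniform_sphere :: 'a::euclidean_space measure)"
  unfolding uniform_sphere_def
  by (rule prob_space.prob_space_distr[OF prob_space_uniform_measure[OF emeasure_unit_ball]]) simp

lemma AE_uniform_sphere: "AE u in (uniform_sphere :: 'a::euclidean_space measure). norm u = 1"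
proof -
  have "AE x in lborel. x \<noteq> (0::'a)" by (rule AE_lborel_singleton)
  then have "AE x in uniform_measure lborel (ball (0::'a) 1). norm (sgn x) = 1"
    by (intro AE_uniform_measureI) (auto simp: norm_sgn elim: eventually_mono)
  then show ?thesis
    unfolding uniform_sphere_def by (subst AE_distr_iff) (auto simp: norm_sgn)
qed

lemma emeasure_uniform_sphere:
  assumes A: "A \<in> sets borel"
  shows "emeasure uniform_sphere A =
    emeasure lborel {x \<in> ball (0::'a::euclidean_space) 1. sgn x \<in> A} / emeasure lborel (ball (0::'a) 1)"
proof -
  have m: "(sgn :: 'a \<Rightarrow> 'a) -` A \<in> sets borel"
    using measurable_sets_borel[OF sgn_borel_measurable A] .
  have eq: "{x \<in> ball (0::'a) 1. sgn x \<in> A} = ball 0 1 \<inter> (sgn :: 'a \<Rightarrow> 'a) -` A"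
    by auto
  show ?thesis
    unfolding uniform_sphere_def eq using A m
    by (subst emeasure_distr) (auto simp: emeasure_uniform_measure)
qed

lemma lborel_distr_orthogonal_transformation:
  fixes T :: "'a::euclidean_space \<Rightarrow> 'a"
  assumes T: "orthogonal_transformation T"
  shows "distr lborel borel T = lborel"
proof (rule measure_eqI)
  have lin: "linear T" and nrm: "\<And>v. norm (T v) = norm v"
    using T by (auto simp: orthogonal_transformation)
  have Tm [measurable]: "T \<in> borel_measurable borel"
    using lin by (simp add: borel_measurable_continuous_onI linear_continuous_on linear_linear)
  define \<nu> where "\<nu> = distr lborel borel T"
  have sets_\<nu> [measurable_cong, simp]: "sets \<nu> = sets borel" by (simp add: \<nu>_def)
  have nn: "(\<integral>\<^sup>+z. F z \<partial>\<nu>) = (\<integral>\<^sup>+z. F (T z) \<partial>lborel)"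
    if [measurable]: "F \<in> borel_measurable borel" for F :: "'a \<Rightarrow> ennreal"
    unfolding \<nu>_def by (subst nn_integral_distr) auto
  have transl: "(\<integral>\<^sup>+z. F (c + z) \<partial>lborel) = (\<integral>\<^sup>+z. F z \<partial>lborel)"
    if [measurable]: "F \<in> borel_measurable borel" for F :: "'a \<Rightarrow> ennreal" and c
    by (subst (2) lborel_distr_plus[of c, symmetric], subst nn_integral_distr) auto
  have neg: "lborel = distr (lborel :: 'a measure) borel uminus"
    by (subst lborel_affine[of "-1" 0]) (auto simp: density_1)
  have refl: "(\<integral>\<^sup>+z. F (- z) \<partial>lborel) = (\<integral>\<^sup>+z. F z \<partial>lborel)"
    if [measurable]: "F \<in> borel_measurable borel" for F :: "'a \<Rightarrow> ennreal"
    by (subst (2) neg, subst nn_integral_distr) auto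
  have transl_\<nu>: "(\<integral>\<^sup>+z. F (c + T z) \<partial>lborel) = (\<integral>\<^sup>+z. F (T z) \<partial>lborel)"
    if [measurable]: "F \<in> borel_measurable borel" for F :: "'a \<Rightarrow> ennreal" and c
  proof -
    obtain d where "c = T d" using orthogonal_transformation_surj[OF T] by (metis surjD)
    then have "(\<integral>\<^sup>+z. F (c + T z) \<partial>lborel) = (\<integral>\<^sup>+z. F (T (d + z)) \<partial>lborel)"
      by (simp add: linear_add[OF lin])
    also have "\<dots> = (\<integral>\<^sup>+z. F (T z) \<partial>lborel)"
      by (rule transl) measurable
    finally show ?thesis .
  qed
  fix A assume "A \<in> sets (distr lborel borel T)"
  then have A [measurable]: "A \<in> sets borel" by simp
  let ?B = "ball (0::'a) 1"
  let ?A1 = "indicator A :: 'a \<Rightarrow> ennreal" and ?B1 = "indicator ?B :: 'a \<Rightarrow> ennreal"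
  have [measurable]: "?B \<in> sets borel" by simp
  have "(\<integral>\<^sup>+x. ?A1 (T x) \<partial>lborel) * (\<integral>\<^sup>+y. ?B1 y \<partial>lborel)
      = (\<integral>\<^sup>+x. (\<integral>\<^sup>+y. ?A1 (T x) * ?B1 y \<partial>lborel) \<partial>lborel)"
    by (simp add: nn_integral_cmult nn_integral_multc)
  also have "\<dots> = (\<integral>\<^sup>+x. (\<integral>\<^sup>+y. ?A1 (T x) * ?B1 (T x + y) \<partial>lborel) \<partial>lborel)"
  proof (rule nn_integral_cong)
    fix x :: 'a
    show "(\<integral>\<^sup>+y. ?A1 (T x) * ?B1 y \<partial>lborel) = (\<integral>\<^sup>+y. ?A1 (T x) * ?B1 (T x + y) \<partial>lborel)"
      by (rule transl[of "\<lambda>y. ?A1 (T x) * ?B1 y" "T x", symmetric]) measurable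
  qed
  also have "\<dots> = (\<integral>\<^sup>+y. (\<integral>\<^sup>+x. ?A1 (T x) * ?B1 (T x + y) \<partial>lborel) \<partial>lborel)"
    by (rule lborel_pair.Fubini'[symmetric]) measurable
  also have "\<dots> = (\<integral>\<^sup>+y. (\<integral>\<^sup>+x. ?A1 (T x - y) * ?B1 (T x) \<partial>lborel) \<partial>lborel)"
  proof (rule nn_integral_cong)
    fix y :: 'a
    have "(\<integral>\<^sup>+x. ?A1 (- y + T x) * ?B1 (- y + T x + y) \<partial>lborel)
        = (\<integral>\<^sup>+x. ?A1 (T x) * ?B1 (T x + y) \<partial>lborel)"
      by (rule transl_\<nu>[of "\<lambda>z. ?A1 z * ?B1 (z + y)" "- y"]) measurable
    then show "(\<integral>\<^sup>+x. ?A1 (T x) * ?B1 (T x + y) \<partial>lborel)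
        = (\<integral>\<^sup>+x. ?A1 (T x - y) * ?B1 (T x) \<partial>lborel)" by simp
  qed
  also have "\<dots> = (\<integral>\<^sup>+x. (\<integral>\<^sup>+y. ?A1 (T x - y) * ?B1 (T x) \<partial>lborel) \<partial>lborel)"
    by (rule lborel_pair.Fubini') measurable
  also have "\<dots> = (\<integral>\<^sup>+x. (\<integral>\<^sup>+y. ?A1 y \<partial>lborel) * ?B1 (T x) \<partial>lborel)"
  proof (rule nn_integral_cong)
    fix x :: 'a
    have "(\<integral>\<^sup>+y. ?A1 (T x - y) \<partial>lborel) = (\<integral>\<^sup>+y. ?A1 (T x + y) \<partial>lborel)"
      using refl[of "\<lambda>y. ?A1 (T x + y)"] by simp
    also have "\<dots> = (\<integral>\<^sup>+y. ?A1 y \<partial>lborel)"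
      by (rule transl) measurable
    finally show "(\<integral>\<^sup>+y. ?A1 (T x - y) * ?B1 (T x) \<partial>lborel) = (\<integral>\<^sup>+y. ?A1 y \<partial>lborel) * ?B1 (T x)"
      by (simp add: nn_integral_multc)
  qed
  also have "\<dots> = (\<integral>\<^sup>+y. ?A1 y \<partial>lborel) * (\<integral>\<^sup>+x. ?B1 (T x) \<partial>lborel)"
    by (rule nn_integral_cmult) measurable
  also have "(\<lambda>x. ?B1 (T x)) = ?B1" by (auto simp: indicator_def nrm)
  finally have "emeasure \<nu> A * emeasure lborel ?B = emeasure lborel A * emeasure lborel ?B"
    using nn[of ?A1] by simp
  then show "emeasure (distr lborel borel T) A = emeasure lborel A"
    using emeasure_unit_ball[where 'a='a] unfolding \<nu>_def infinity_ennreal_def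
    by (metis ennreal_mult_divide_eq)
qed simp

lemma orthogonal_invariant_uniform_sphere:
  fixes T :: "'a::euclidean_space \<Rightarrow> 'a"
  assumes T: "orthogonal_transformation T"
  shows "distr uniform_sphere borel T = uniform_sphere"
proof (rule measure_eqI)
  have lin: "linear T" and nrm: "\<And>v. norm (T v) = norm v"
    using T by (auto simp: orthogonal_transformation)
  have sgnT: "sgn (T v) = T (sgn v)" for v
    by (simp add: sgn_div_norm nrm linear_scale[OF lin])
  have Tm: "T \<in> borel_measurable borel"
    using lin by (simp add: borel_measurable_continuous_onI linear_continuous_on linear_linear)
  fix A assume "A \<in> sets (distr uniform_sphere borel T)"
  then have A: "A \<in> sets borel" by simp
  let ?S = "\<lambda>A. {x \<in> ball (0::'a) 1. sgn x \<in> A}"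
  have TA: "T -` A \<in> sets borel" using measurable_sets_borel[OF Tm A] .
  have "?S A = ball 0 1 \<inter> sgn -` A" by auto
  then have SA: "?S A \<in> sets borel"
    using measurable_sets_borel[OF sgn_borel_measurable A] by auto
  have "emeasure lborel (?S A) = emeasure (distr lborel borel T) (?S A)"
    by (simp add: lborel_distr_orthogonal_transformation[OF T])
  also have "\<dots> = emeasure lborel (T -` ?S A)"
    using SA Tm by (subst emeasure_distr) auto
  also have "T -` ?S A = ?S (T -` A)"
    by (auto simp: sgnT nrm)
  finally show "emeasure (distr uniform_sphere borel T) A = emeasure uniform_sphere A"
    using A TA Tm by (simp add: emeasure_distr emeasure_uniform_sphere)
qed simp


subsection \<open>The gradient estimate\<close>

definition spherical_smoothing ::
    "(real ^ 'n \<Rightarrow> real) \<Rightarrow> real ^ 'n \<Rightarrow> real \<Rightarrow> nat \<Rightarrow> (nat \<Rightarrow> real ^ 'n) \<Rightarrow> real ^ 'n" where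
  "spherical_smoothing f x \<Delta> N u =
     (real CARD('n) / real N) *\<^sub>R (\<Sum>i = 1..N. ((f (x + \<Delta> *\<^sub>R u i) - f x) / \<Delta>) *\<^sub>R u i)"

text \<open>The minimum of the lengths of the previous and the current step; there is no step before
  the first one.\<close>

definition min_step :: "(nat \<Rightarrow> 'a::real_normed_vector) \<Rightarrow> nat \<Rightarrow> real" where
  "min_step s k = (if k = 0 then norm (s 0) else min (norm (s (k - 1))) (norm (s k)))"

end

theory Submission
  imports Defs
begin

text \<open>
  Write \<open>w = s (k - 1)\<close> and \<open>e = w / norm w\<close>. Strong convexity gives
  \<open>(gradf (x k) - gradf (x (k - 1))) \<bullet> e \<ge> \<mu> * norm w\<close>, so the claim can only fail if the estimate at
  \<open>x k\<close> falls short of the gradient, or the estimate at \<open>x (k - 1)\<close> exceeds it, by at least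
  \<open>\<mu> * norm w / 2\<close> in the single direction \<open>e\<close>. Both minimal step lengths \<open>m\<close> involved are at most \<open>norm w\<close>,
  and each of the two deviations of size \<open>\<mu> * m / 2\<close> is shown to have probability at most
  \<open>\<nu> / (n + 1)\<close>; since \<open>n \<ge> 1\<close>, the two together have probability at most \<open>\<nu>\<close>.

  As only one direction matters, a bound on the norm of the error of the gradient estimate is not
  needed: the projected estimate is an average of independent bounded real variables, and the scalar
  one-sided Bernstein inequality \<open>Bernstein_ineq_sum_ge\<close> applies without a dimension factor. The factor
  \<open>n + 1\<close> inside the logarithm of the sample size is thus available for the union bound.

  The mean and the second moment of one summand come from \<open>spherical_sample_moments\<close>. The covariance
  matrix of a uniform unit vector is \<open>1 / n\<close> times the identity, so the linear part of \<open>f\<close> is estimated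
  without bias. The remainder of the difference quotient lies in \<open>[0, L * \<Delta> / 2]\<close> and contributes a
  bias of at most \<open>sqrt n * L * \<Delta> / 4 = \<theta> * \<mu> * m / 4\<close>. For \<open>n > 16\<close> this is larger than the bound \<open>L * \<Delta>\<close>
  obtained by differentiating the average of \<open>f\<close> over a ball, but it uses no integration by parts, and
  \<open>sample_size_constants\<close> shows that the prescribed sample size still suffices: the scalar second
  moment is smaller than the prescribed size allows for, by a factor of two in the term with the
  gradient.
\<close>

section \<open>Bernstein's inequality\<close>

text \<open>The coefficients of the exponential series satisfy \<open>(k + 2)! \<ge> 2 * 3 ^ k\<close>, so its tail is dominated
  by a geometric series of ratio \<open>b / 3\<close>.\<close>

lemma exp_le_quadratic_over_linear:
  fixes x b :: real
  assumes x: "\<bar>x\<bar> \<le> b" and b: "b < 3"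
  shows "exp x \<le> 1 + x + x\<^sup>2 / (2 * (1 - b / 3))"
proof -
  have b0: "0 \<le> b" using x by linarith
  have sums: "(\<lambda>k. x\<^sup>2 / 2 * (b / 3) ^ k) sums (x\<^sup>2 / 2 * (1 / (1 - b / 3)))"
    using b0 b by (intro sums_mult geometric_sums) simp
  have "(\<Sum>k. inverse (fact (k + 2)) *\<^sub>R x ^ (k + 2)) \<le> (\<Sum>k. x\<^sup>2 / 2 * (b / 3) ^ k)"
  proof (rule suminf_le)
    fix k
    have "(2::nat) * 3 ^ k \<le> fact (k + 2)"
      by (induct k) simp_all
    then have "real (2 * 3 ^ k) \<le> real (fact (k + 2))"
      by (simp only: of_nat_le_iff)
    then have "(2::real) * 3 ^ k \<le> fact (k + 2)"
      unfolding of_nat_fact by simp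
    then have inv: "inverse (fact (k + 2)) \<le> inverse ((2::real) * 3 ^ k)"
      by (rule le_imp_inverse_le) simp
    have "x ^ k \<le> b ^ k"
      using power_mono[OF x, of k] abs_ge_self[of "x ^ k"] by (simp add: power_abs)
    then have "x ^ (k + 2) \<le> b ^ k * x\<^sup>2"
      unfolding power_add by (intro mult_right_mono) auto
    then have "inverse (fact (k + 2)) * x ^ (k + 2) \<le> inverse (fact (k + 2)) * (b ^ k * x\<^sup>2)"
      by (intro mult_left_mono) auto
    also have "\<dots> \<le> inverse ((2::real) * 3 ^ k) * (b ^ k * x\<^sup>2)"
      using b0 by (intro mult_right_mono inv) auto
    finally show "inverse (fact (k + 2)) *\<^sub>R x ^ (k + 2) \<le> x\<^sup>2 / 2 * (b / 3) ^ k"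
      by (simp add: power_divide field_simps del: fact_Suc)
  next
    show "summable (\<lambda>k. inverse (fact (k + 2)) *\<^sub>R x ^ (k + 2))"
      by (rule summable_exp_generic[THEN summable_ignore_initial_segment])
    show "summable (\<lambda>k. x\<^sup>2 / 2 * (b / 3) ^ k)"
      by (rule sums_summable[OF sums])
  qed
  also have "\<dots> = x\<^sup>2 / (2 * (1 - b / 3))"
    using sums_unique[OF sums] by simp
  finally show ?thesis
    unfolding exp_first_two_terms[of x] by simp
qed

lemma (in prob_space) integrable_AE_bounded:
  fixes X :: "'a \<Rightarrow> real"
  assumes "X \<in> borel_measurable M" "AE \<omega> in M. \<bar>X \<omega>\<bar> \<le> b"
  shows "integrable M X"
  by (rule integrable_const_bound[where B = b]) (use assms in auto)

text \<open>The bound on the moment generating function uses the second moment about \<open>0\<close>, so the bound \<open>b\<close>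
  is one for the variable itself and not for its deviation from the mean.\<close>

lemma (in prob_space) expectation_exp_le:
  fixes X :: "'a \<Rightarrow> real"
  assumes [measurable]: "X \<in> borel_measurable M"
    and bound: "AE \<omega> in M. \<bar>X \<omega>\<bar> \<le> b"
    and mean: "expectation X \<le> m"
    and second: "expectation (\<lambda>\<omega>. (X \<omega>)\<^sup>2) \<le> v"
    and l: "0 \<le> l" "l * b < 3"
  shows "expectation (\<lambda>\<omega>. exp (l * X \<omega>)) \<le> exp (l * m + l\<^sup>2 * v / (2 * (1 - l * b / 3)))"
proof -
  define c where "c = 2 * (1 - l * b / 3)"
  have c: "c > 0" using l by (simp add: c_def mult.commute)
  have bound': "AE \<omega> in M. \<bar>l * X \<omega>\<bar> \<le> l * b"
    using bound by eventually_elim (use l in \<open>auto simp: abs_mult intro: mult_left_mono\<close>)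
  have int1: "integrable M X"
    by (rule integrable_AE_bounded[OF _ bound]) simp
  have int2: "integrable M (\<lambda>\<omega>. (X \<omega>)\<^sup>2)"
    by (rule integrable_AE_bounded[where b = "b\<^sup>2"])
       (use bound in \<open>auto elim!: eventually_mono simp: abs_le_square_iff[symmetric]\<close>)
  have inte: "integrable M (\<lambda>\<omega>. exp (l * X \<omega>))"
    by (rule integrable_AE_bounded[where b = "exp (l * b)"])
       (use bound' in \<open>auto elim!: eventually_mono\<close>)
  have "expectation (\<lambda>\<omega>. exp (l * X \<omega>)) \<le> expectation (\<lambda>\<omega>. 1 + l * X \<omega> + l\<^sup>2 / c * (X \<omega>)\<^sup>2)"
  proof (rule integral_mono_AE)
    show "AE \<omega> in M. exp (l * X \<omega>) \<le> 1 + l * X \<omega> + l\<^sup>2 / c * (X \<omega>)\<^sup>2"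
      using bound'
    proof eventually_elim
      case (elim \<omega>)
      from exp_le_quadratic_over_linear[OF elim l(2)] show ?case
        by (simp add: c_def power_mult_distrib)
    qed
  qed (use inte int1 int2 in auto)
  also have "\<dots> = 1 + l * expectation X + l\<^sup>2 / c * expectation (\<lambda>\<omega>. (X \<omega>)\<^sup>2)"
    using int1 int2 by (simp add: prob_space)
  also have "\<dots> \<le> 1 + (l * m + l\<^sup>2 / c * v)"
    using mult_left_mono[OF mean l(1)] mult_left_mono[OF second, of "l\<^sup>2 / c"] c by simp
  also have "\<dots> \<le> exp (l * m + l\<^sup>2 / c * v)"
    by (rule exp_ge_add_one_self)
  finally show ?thesis by (simp add: c_def)
qed

text \<open>Bernstein's inequality for the upper tail of a sum of bounded, possibly uncentred variables; their
  means and second moments enter only through common upper bounds \<open>m\<close> and \<open>v\<close>.\<close>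

theorem (in prob_space) Bernstein_ineq_sum_ge:
  fixes X :: "'i \<Rightarrow> 'a \<Rightarrow> real"
  assumes fin: "finite I"
    and indep: "indep_vars (\<lambda>_. borel) X I"
    and bound: "\<And>i. i \<in> I \<Longrightarrow> AE \<omega> in M. \<bar>X i \<omega>\<bar> \<le> b"
    and mean: "\<And>i. i \<in> I \<Longrightarrow> expectation (X i) \<le> m"
    and second: "\<And>i. i \<in> I \<Longrightarrow> expectation (\<lambda>\<omega>. (X i \<omega>)\<^sup>2) \<le> v"
    and pos: "0 \<le> b" "0 < v" "0 < t"
  shows "prob {\<omega> \<in> space M. (\<Sum>i\<in>I. X i \<omega>) \<ge> real (card I) * (m + t)}
    \<le> exp (- (real (card I) * t\<^sup>2 / (2 * (v + b * t / 3))))"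
proof -
  let ?n = "real (card I)"
  define d where "d = v + b * t / 3"
  \<comment> \<open>With this parameter of the exponential, the term in \<open>v\<close> below becomes \<open>l * t / 2\<close>, half of the gain
    \<open>l * t\<close>.\<close>
  define l where "l = t / d"
  have d: "d > 0" using pos by (simp add: d_def add_pos_nonneg)
  have l: "l > 0" using d pos by (simp add: l_def)
  have lb: "1 - l * b / 3 = v / d"
  proof -
    have "l * b / 3 = (b * t / 3) / d" by (simp add: l_def mult.commute)
    also have "b * t / 3 = d - v" by (simp add: d_def)
    finally have "l * b / 3 = (d - v) / d" .
    then show ?thesis using d by (simp add: diff_divide_distrib)
  qed
  moreover have "0 < v / d" using d pos by simp
  ultimately have lb3: "l * b < 3" by simp
  have rv: "random_variable borel (X i)" if "i \<in> I" for i
    using indep that by (auto simp: indep_vars_def)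
  have indepe: "indep_vars (\<lambda>_. borel) (\<lambda>i \<omega>. exp (l * X i \<omega>)) I"
    by (rule indep_vars_compose2[OF indep]) simp
  have inte: "integrable M (\<lambda>\<omega>. exp (l * X i \<omega>))" if "i \<in> I" for i
    by (rule integrable_AE_bounded[where b = "exp (l * b)"])
       (use bound[OF that] rv[OF that] l in \<open>auto elim!: eventually_mono intro: mult_left_mono\<close>)
  have prod: "exp (l * (\<Sum>i\<in>I. X i \<omega>)) = (\<Prod>i\<in>I. exp (l * X i \<omega>))" for \<omega>
    by (simp add: sum_distrib_left exp_sum fin)
  have "{\<omega> \<in> space M. (\<Sum>i\<in>I. X i \<omega>) \<ge> ?n * (m + t)}
      = {\<omega> \<in> space M. exp (l * (\<Sum>i\<in>I. X i \<omega>)) \<ge> exp (l * (?n * (m + t)))}"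
    using l by simp
  also have "prob \<dots> \<le> expectation (\<lambda>\<omega>. exp (l * (\<Sum>i\<in>I. X i \<omega>))) / exp (l * (?n * (m + t)))"
    using indep_vars_integrable[OF fin indepe inte]
    by (intro integral_Markov_inequality_measure[where A = "space M"]) (auto simp: prod intro!: prod_nonneg)
  also have "expectation (\<lambda>\<omega>. exp (l * (\<Sum>i\<in>I. X i \<omega>)))
      = (\<Prod>i\<in>I. expectation (\<lambda>\<omega>. exp (l * X i \<omega>)))"
    unfolding prod by (rule indep_vars_lebesgue_integral[OF fin indepe inte])
  also have "\<dots> \<le> (\<Prod>i\<in>I. exp (l * m + l\<^sup>2 * v / (2 * (1 - l * b / 3))))"
    using l lb3 rv bound mean second by (intro prod_mono conjI expectation_exp_le) auto
  also have "\<dots> = exp (?n * (l * m + l\<^sup>2 * v / (2 * (1 - l * b / 3))))"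
    by (simp add: exp_of_nat_mult)
  also have "l\<^sup>2 * v / (2 * (1 - l * b / 3)) = l * t / 2"
    unfolding lb using d pos by (simp add: l_def power2_eq_square)
  also have "exp (?n * (l * m + l * t / 2)) / exp (l * (?n * (m + t))) = exp (- (?n * (l * t / 2)))"
    unfolding exp_diff[symmetric] by (simp add: algebra_simps)
  also have "l * t / 2 = t\<^sup>2 / (2 * d)" by (simp add: l_def power2_eq_square)
  finally show ?thesis
    by (simp add: d_def divide_right_mono)
qed

section \<open>Strongly convex functions with Lipschitz gradient\<close>

lemma has_real_derivative_along_line:
  assumes "GDERIV f (x + t *\<^sub>R d) :> D"
  shows "((\<lambda>t. f (x + t *\<^sub>R d)) has_real_derivative d \<bullet> D) (at t)"
proof -
  have "((\<lambda>t. x + t *\<^sub>R d) has_derivative (\<lambda>h. h *\<^sub>R d)) (at t)"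
    by (auto intro!: derivative_eq_intros)
  from has_derivative_compose[OF this, of f "\<lambda>h. h \<bullet> D"]
  have "((\<lambda>t. f (x + t *\<^sub>R d)) has_derivative (\<lambda>h. (h *\<^sub>R d) \<bullet> D)) (at t)"
    using assms by (simp add: gderiv_def)
  then show ?thesis
    by (simp add: has_field_derivative_def mult.commute[of _ "d \<bullet> D"])
qed

lemma borel_measurable_GDERIV:
  fixes f :: "'a::euclidean_space \<Rightarrow> real"
  assumes "\<And>z. GDERIV f z :> gradf z"
  shows "f \<in> borel_measurable borel"
proof (rule borel_measurable_continuous_onI)
  show "continuous_on UNIV f"
    using assms unfolding gderiv_def
    by (intro continuous_at_imp_continuous_on ballI) (blast intro: has_derivative_continuous)
qed

lemma Lipschitz_gradient_upper_bound:
  fixes f :: "'a::real_inner \<Rightarrow> real"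
  assumes grad: "\<And>z. GDERIV f z :> gradf z"
    and lip: "L-lipschitz_on UNIV gradf"
  shows "f (x + d) \<le> f x + gradf x \<bullet> d + L / 2 * (norm d)\<^sup>2"
proof -
  let ?\<phi> = "\<lambda>t. f (x + t *\<^sub>R d) - t * (d \<bullet> gradf x) - L / 2 * (norm d)\<^sup>2 * t\<^sup>2"
  have "?\<phi> 1 \<le> ?\<phi> 0"
  proof (rule DERIV_nonpos_imp_nonincreasing[of 0 1 ?\<phi>])
    fix t :: real assume t: "0 \<le> t" "t \<le> 1"
    have "(?\<phi> has_real_derivative
        d \<bullet> gradf (x + t *\<^sub>R d) - d \<bullet> gradf x - L * (norm d)\<^sup>2 * t) (at t)"
      by (rule derivative_eq_intros has_real_derivative_along_line[OF grad] refl | simp)+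
    moreover have "d \<bullet> gradf (x + t *\<^sub>R d) - d \<bullet> gradf x - L * (norm d)\<^sup>2 * t \<le> 0"
    proof -
      have "d \<bullet> gradf (x + t *\<^sub>R d) - d \<bullet> gradf x \<le> norm d * norm (gradf (x + t *\<^sub>R d) - gradf x)"
        using norm_cauchy_schwarz[of d "gradf (x + t *\<^sub>R d) - gradf x"] by (simp add: inner_diff_right)
      also have "\<dots> \<le> norm d * (L * norm (t *\<^sub>R d))"
        using lipschitz_onD[OF lip, of "x + t *\<^sub>R d" x] by (intro mult_left_mono) (auto simp: dist_norm)
      finally show ?thesis using t by (simp add: power2_eq_square mult_ac)
    qed
    ultimately show "\<exists>y. (?\<phi> has_real_derivative y) (at t) \<and> y \<le> 0" by blast
  qed simp
  then show ?thesis by (simp add: inner_commute)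
qed

text \<open>The chord inequality from \<open>x\<close> to \<open>x + d\<close> bounds the difference quotient at every \<open>t\<close> in \<open>(0, 1)\<close>;
  the claim is its limit as \<open>t\<close> tends to \<open>0\<close>.\<close>

lemma strongly_convex_lower_bound:
  fixes f :: "'a::real_inner \<Rightarrow> real"
  assumes grad: "GDERIV f x :> D"
    and sc: "strongly_convex \<mu> f"
  shows "f x + D \<bullet> d + \<mu> / 2 * (norm d)\<^sup>2 \<le> f (x + d)"
proof -
  have "((\<lambda>t. f (x + t *\<^sub>R d)) has_real_derivative d \<bullet> D) (at 0)"
    by (rule has_real_derivative_along_line) (simp add: grad)
  then have lim: "((\<lambda>t. (f (x + t *\<^sub>R d) - f x) / t) \<longlongrightarrow> d \<bullet> D) (at_right 0)"
    by (auto simp: DERIV_def intro: filterlim_mono[OF _ order_refl at_le])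
  have lim2: "((\<lambda>t. f (x + d) - f x - \<mu> / 2 * (1 - t) * (norm d)\<^sup>2)
      \<longlongrightarrow> f (x + d) - f x - \<mu> / 2 * (1 - 0) * (norm d)\<^sup>2) (at_right (0::real))"
    by (intro tendsto_intros)
  have "d \<bullet> D \<le> f (x + d) - f x - \<mu> / 2 * (1 - 0) * (norm d)\<^sup>2"
  proof (rule tendsto_le[OF _ lim2 lim])
    have "\<forall>\<^sub>F t::real in at_right 0. t \<in> {0<..<1}"
      by (rule eventually_at_right_real) simp
    then show "\<forall>\<^sub>F t in at_right 0. (f (x + t *\<^sub>R d) - f x) / t
        \<le> f (x + d) - f x - \<mu> / 2 * (1 - t) * (norm d)\<^sup>2"
    proof eventually_elim
      case (elim t)
      then have "f (t *\<^sub>R (x + d) + (1 - t) *\<^sub>R x)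
          \<le> t * f (x + d) + (1 - t) * f x - \<mu> / 2 * t * (1 - t) * (norm (x + d - x))\<^sup>2"
        using sc unfolding strongly_convex_def by (meson atLeastAtMost_iff greaterThanLessThan_iff less_imp_le)
      moreover have "t *\<^sub>R (x + d) + (1 - t) *\<^sub>R x = x + t *\<^sub>R d"
        by (simp add: algebra_simps)
      ultimately have "f (x + t *\<^sub>R d) - f x
          \<le> (f (x + d) - f x - \<mu> / 2 * (1 - t) * (norm d)\<^sup>2) * t"
        by (simp add: algebra_simps)
      then show ?case using elim by (simp add: divide_le_eq)
    qed
  qed simp
  then show ?thesis by (simp add: inner_commute)
qed

lemma strongly_convex_gradient_monotone:
  fixes f :: "'a::real_inner \<Rightarrow> real"
  assumes grad: "\<And>z. GDERIV f z :> gradf z"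
    and sc: "strongly_convex \<mu> f"
  shows "\<mu> * (norm (y - x))\<^sup>2 \<le> (gradf y - gradf x) \<bullet> (y - x)"
  using strongly_convex_lower_bound[OF grad sc, of x "y - x"]
    strongly_convex_lower_bound[OF grad sc, of y "x - y"]
  by (simp add: inner_diff_left inner_diff_right norm_minus_commute)

section \<open>Moments of the uniform distribution on the sphere\<close>

lemma integrable_uniform_sphere_bounded:
  fixes \<phi> :: "'a::euclidean_space \<Rightarrow> real"
  assumes "\<phi> \<in> borel_measurable borel" "\<And>u. norm u = 1 \<Longrightarrow> \<bar>\<phi> u\<bar> \<le> B"
  shows "integrable uniform_sphere \<phi>"
proof -
  interpret prob_space "uniform_sphere :: 'a measure" by (rule prob_space_uniform_sphere)
  have "AE u in uniform_sphere. \<bar>\<phi> u\<bar> \<le> B"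
    using AE_uniform_sphere by eventually_elim (use assms in auto)
  with assms(1) show ?thesis
    by (intro integrable_AE_bounded) (auto simp: measurable_def)
qed

lemma integral_uniform_sphere_orthogonal:
  fixes T :: "'a::euclidean_space \<Rightarrow> 'a" and \<phi> :: "'a \<Rightarrow> real"
  assumes T: "orthogonal_transformation T" and \<phi>: "\<phi> \<in> borel_measurable borel"
  shows "(\<integral>u. \<phi> (T u) \<partial>uniform_sphere) = (\<integral>u. \<phi> u \<partial>uniform_sphere)"
proof -
  have "T \<in> borel_measurable borel"
    using T by (auto simp: orthogonal_transformation linear_linear
        intro!: borel_measurable_continuous_onI linear_continuous_on)
  then have "(\<integral>u. \<phi> u \<partial>distr uniform_sphere borel T) = (\<integral>u. \<phi> (T u) \<partial>uniform_sphere)"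
    using \<phi> by (intro integral_distr) (auto simp: measurable_def)
  then show ?thesis
    by (simp add: orthogonal_invariant_uniform_sphere[OF T])
qed

lemma integral_uniform_sphere_inner:
  fixes e :: "'a::euclidean_space"
  shows "(\<integral>u. u \<bullet> e \<partial>uniform_sphere) = 0"
proof -
  have "orthogonal_transformation (\<lambda>u::'a. - u)"
    by (simp add: orthogonal_transformation_neg orthogonal_transformation_id[unfolded id_def])
  from integral_uniform_sphere_orthogonal[OF this, of "\<lambda>u. u \<bullet> e"]
  show ?thesis by simp
qed

lemma integrable_uniform_sphere_inner_mult:
  fixes a b :: "'a::euclidean_space"
  shows "integrable uniform_sphere (\<lambda>u. (u \<bullet> a) * (u \<bullet> b))"
proof (rule integrable_uniform_sphere_bounded)
  fix u :: 'a assume "norm u = 1"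
  then show "\<bar>(u \<bullet> a) * (u \<bullet> b)\<bar> \<le> norm a * norm b"
    using Cauchy_Schwarz_ineq2[of u a] Cauchy_Schwarz_ineq2[of u b]
    by (auto simp: abs_mult intro!: mult_mono)
qed simp

text \<open>By invariance under orthogonal maps, the second moment depends only on the length of \<open>e\<close>; summed over an
  orthogonal basis of vectors of that length, the second moments add up to \<open>(norm e)\<^sup>2\<close>.\<close>

lemma integral_uniform_sphere_inner_power2:
  fixes e :: "real ^ 'n"
  shows "(\<integral>u. (u \<bullet> e)\<^sup>2 \<partial>uniform_sphere) = (norm e)\<^sup>2 / real CARD('n)"
proof -
  interpret prob_space "uniform_sphere :: (real ^ 'n) measure" by (rule prob_space_uniform_sphere)
  let ?I = "\<lambda>e :: real ^ 'n. (\<integral>u. (u \<bullet> e)\<^sup>2 \<partial>uniform_sphere)"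
  have int: "integrable uniform_sphere (\<lambda>u. (u \<bullet> e)\<^sup>2)" for e :: "real ^ 'n"
    unfolding power2_eq_square by (rule integrable_uniform_sphere_inner_mult)
  have eq: "?I e = ?I e'" if "norm e = norm e'" for e e' :: "real ^ 'n"
  proof -
    obtain T where T: "orthogonal_transformation T" "T e = e'"
      using orthogonal_transformation_exists[OF \<open>norm e = norm e'\<close>] by blast
    have "T u \<bullet> e' = u \<bullet> e" for u
      using T by (auto simp: orthogonal_transformation_def)
    with integral_uniform_sphere_orthogonal[OF T(1), of "\<lambda>u. (u \<bullet> e')\<^sup>2"] show ?thesis by simp
  qed
  have "(norm e)\<^sup>2 = (\<integral>u. (norm u)\<^sup>2 * (norm e)\<^sup>2 \<partial>(uniform_sphere :: (real ^ 'n) measure))"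
  proof -
    have "(\<integral>u. (norm u)\<^sup>2 * (norm e)\<^sup>2 \<partial>(uniform_sphere :: (real ^ 'n) measure))
        = (\<integral>u. (norm e)\<^sup>2 \<partial>(uniform_sphere :: (real ^ 'n) measure))"
      by (intro integral_cong_AE eventually_mono[OF AE_uniform_sphere]) auto
    then show ?thesis using prob_space by simp
  qed
  also have "\<dots> = (\<integral>u. (\<Sum>b\<in>Basis. (u \<bullet> (norm e *\<^sub>R b))\<^sup>2) \<partial>(uniform_sphere :: (real ^ 'n) measure))"
  proof (rule Bochner_Integration.integral_cong[OF refl])
    fix u :: "real ^ 'n"
    have "(norm u)\<^sup>2 = (\<Sum>b\<in>Basis. (u \<bullet> b)\<^sup>2)"
      by (subst power2_norm_eq_inner, subst euclidean_inner) (simp add: power2_eq_square)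
    then show "(norm u)\<^sup>2 * (norm e)\<^sup>2 = (\<Sum>b\<in>Basis. (u \<bullet> (norm e *\<^sub>R b))\<^sup>2)"
      by (simp add: sum_distrib_left power_mult_distrib mult.commute)
  qed
  also have "\<dots> = (\<Sum>b\<in>Basis. ?I (norm e *\<^sub>R (b :: real ^ 'n)))"
    by (rule Bochner_Integration.integral_sum) (rule int)
  also have "\<dots> = (\<Sum>b\<in>(Basis :: (real ^ 'n) set). ?I e)"
    by (intro sum.cong[OF refl] eq) simp
  also have "\<dots> = real CARD('n) * ?I e"
    by simp
  finally show ?thesis by (simp add: field_simps)
qed

text \<open>Polarisation: the covariance matrix of a uniform unit vector is the identity divided by the
  dimension.\<close>

lemma integral_uniform_sphere_inner_mult:
  fixes a b :: "real ^ 'n"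
  shows "(\<integral>u. (u \<bullet> a) * (u \<bullet> b) \<partial>uniform_sphere) = (a \<bullet> b) / real CARD('n)"
proof -
  note int = integrable_uniform_sphere_inner_mult
  have "(norm (a + b))\<^sup>2 / real CARD('n) = (\<integral>u. (u \<bullet> (a + b))\<^sup>2 \<partial>uniform_sphere)"
    by (rule integral_uniform_sphere_inner_power2[symmetric])
  also have "\<dots> = (\<integral>u. (u \<bullet> a) * (u \<bullet> a) + (u \<bullet> b) * (u \<bullet> b) + 2 * ((u \<bullet> a) * (u \<bullet> b)) \<partial>uniform_sphere)"
    by (intro Bochner_Integration.integral_cong[OF refl])
       (simp add: inner_add_right power2_eq_square algebra_simps)
  also have "\<dots> = (\<integral>u. (u \<bullet> a)\<^sup>2 \<partial>uniform_sphere) + (\<integral>u. (u \<bullet> b)\<^sup>2 \<partial>uniform_sphere)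
      + 2 * (\<integral>u. (u \<bullet> a) * (u \<bullet> b) \<partial>uniform_sphere)"
    unfolding power2_eq_square by (simp add: int)
  finally have "2 * (\<integral>u. (u \<bullet> a) * (u \<bullet> b) \<partial>uniform_sphere)
      = ((norm (a + b))\<^sup>2 - (norm a)\<^sup>2 - (norm b)\<^sup>2) / real CARD('n)"
    by (simp add: integral_uniform_sphere_inner_power2 diff_divide_distrib)
  also have "(norm (a + b))\<^sup>2 - (norm a)\<^sup>2 - (norm b)\<^sup>2 = 2 * (a \<bullet> b)"
    by (simp add: power2_norm_eq_inner inner_add_left inner_add_right inner_commute)
  finally show ?thesis by simp
qed

lemma integral_uniform_sphere_abs_inner_le:
  fixes e :: "real ^ 'n"
  shows "(\<integral>u. \<bar>u \<bullet> e\<bar> \<partial>uniform_sphere) \<le> norm e / sqrt (real CARD('n))"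
proof -
  interpret prob_space "uniform_sphere :: (real ^ 'n) measure" by (rule prob_space_uniform_sphere)
  have "integrable uniform_sphere (\<lambda>u. (u \<bullet> e)\<^sup>2)"
    unfolding power2_eq_square by (rule integrable_uniform_sphere_inner_mult)
  moreover have "integrable uniform_sphere (\<lambda>u. \<bar>u \<bullet> e\<bar>)"
    by (rule integrable_uniform_sphere_bounded[where B = "norm e"])
       (auto intro: order_trans[OF Cauchy_Schwarz_ineq2])
  \<comment> \<open>Jensen's inequality, in the form that a variance is nonnegative\<close>
  ultimately have "variance (\<lambda>u. \<bar>u \<bullet> e\<bar>)
      = (\<integral>u. (u \<bullet> e)\<^sup>2 \<partial>uniform_sphere) - (\<integral>u. \<bar>u \<bullet> e\<bar> \<partial>uniform_sphere)\<^sup>2"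
    by (subst variance_eq) auto
  moreover have "variance (\<lambda>u. \<bar>u \<bullet> e\<bar>) \<ge> 0" by (rule variance_positive)
  ultimately have "(\<integral>u. \<bar>u \<bullet> e\<bar> \<partial>uniform_sphere)\<^sup>2 \<le> (norm e)\<^sup>2 / real CARD('n)"
    by (simp add: integral_uniform_sphere_inner_power2)
  also have "\<dots> = (norm e / sqrt (real CARD('n)))\<^sup>2"
    by (simp add: power_divide)
  finally show ?thesis
    by (rule power2_le_imp_le) simp
qed

section \<open>Deviation of the spherical smoothing estimate\<close>

text \<open>
  One summand \<open>X\<close> of the estimate at \<open>x\<close>, tested against a unit vector \<open>e\<close>. The difference quotient is
  \<open>u \<bullet> gradf x + r u\<close> with a remainder \<open>r u\<close> between \<open>0\<close> (convexity) and \<open>K = L * \<Delta> / 2\<close> (Lipschitz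
  gradient). The linear part has mean \<open>gradf x \<bullet> e\<close>. As \<open>u \<bullet> e\<close> has mean \<open>0\<close>, the remainder may be
  centred to \<open>r u - K / 2\<close>, of absolute value at most \<open>K / 2\<close>; this halves the bias compared with
  the bound \<open>\<bar>r u\<bar> \<le> K\<close>.
\<close>

lemma spherical_sample_moments:
  fixes f :: "real ^ 'n \<Rightarrow> real" and gradf :: "real ^ 'n \<Rightarrow> real ^ 'n"
    and x e :: "real ^ 'n" and \<Delta> L \<mu> n :: real
  defines "n \<equiv> real CARD('n)"
  defines "X \<equiv> \<lambda>u. n * ((f (x + \<Delta> *\<^sub>R u) - f x) / \<Delta>) * (u \<bullet> e)"
  assumes grad: "\<And>z. GDERIV f z :> gradf z"
    and lip: "L-lipschitz_on UNIV gradf"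
    and sc: "strongly_convex \<mu> f" "0 \<le> \<mu>"
    and e: "norm e = 1"
    and \<Delta>: "0 < \<Delta>"
  shows spherical_sample_measurable: "X \<in> borel_measurable borel"
    and spherical_sample_bound:
      "\<And>u. norm u = 1 \<Longrightarrow> \<bar>X u\<bar> \<le> n * (norm (gradf x) + L * \<Delta> / 2)"
    and spherical_sample_mean:
      "(\<integral>u. X u \<partial>uniform_sphere) \<le> gradf x \<bullet> e + sqrt n * (L * \<Delta>) / 4"
    and spherical_sample_second_moment:
      "(\<integral>u. (X u)\<^sup>2 \<partial>uniform_sphere) \<le> n * (3 / 2 * (norm (gradf x))\<^sup>2 + 3 / 4 * (L * \<Delta>)\<^sup>2)"
proof -
  define a where "a = gradf x"
  define r where "r = (\<lambda>u. (f (x + \<Delta> *\<^sub>R u) - f x) / \<Delta> - u \<bullet> a)"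
  define K where "K = L * \<Delta> / 2"
  have n: "n > 0" by (simp add: n_def)
  have L: "L \<ge> 0" using lip by (rule lipschitz_on_nonneg)
  then have K: "K \<ge> 0" using \<Delta> by (simp add: K_def)
  have X: "X u = n * (u \<bullet> a + r u) * (u \<bullet> e)" for u
    by (simp add: X_def r_def)
  have [measurable]: "f \<in> borel_measurable borel"
    by (rule borel_measurable_GDERIV[OF grad])
  have [measurable]: "r \<in> borel_measurable borel"
    unfolding r_def by measurable
  show Xm: "X \<in> borel_measurable borel"
    unfolding X_def by measurable
  have r: "0 \<le> r u" "r u \<le> K" if u: "norm u = 1" for u
  proof -
    have "f x + a \<bullet> (\<Delta> *\<^sub>R u) + \<mu> / 2 * (norm (\<Delta> *\<^sub>R u))\<^sup>2 \<le> f (x + \<Delta> *\<^sub>R u)"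
      unfolding a_def by (rule strongly_convex_lower_bound[OF grad sc(1)])
    moreover have "\<mu> / 2 * (norm (\<Delta> *\<^sub>R u))\<^sup>2 \<ge> 0" using sc(2) by simp
    ultimately have "f x + a \<bullet> (\<Delta> *\<^sub>R u) \<le> f (x + \<Delta> *\<^sub>R u)" by linarith
    then show "0 \<le> r u"
      using \<Delta> by (simp add: r_def inner_commute field_simps)
    have "f (x + \<Delta> *\<^sub>R u) \<le> f x + a \<bullet> (\<Delta> *\<^sub>R u) + L / 2 * (norm (\<Delta> *\<^sub>R u))\<^sup>2"
      unfolding a_def by (rule Lipschitz_gradient_upper_bound[OF grad lip])
    then show "r u \<le> K"
      using \<Delta> u by (simp add: r_def K_def inner_commute field_simps power2_eq_square)
  qed
  have ue: "\<bar>u \<bullet> e\<bar> \<le> 1" if "norm u = 1" for u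
    using Cauchy_Schwarz_ineq2[of u e] e that by simp
  have ua: "\<bar>u \<bullet> a\<bar> \<le> norm a" if "norm u = 1" for u
    using Cauchy_Schwarz_ineq2[of u a] that by simp
  have bound: "\<bar>X u\<bar> \<le> n * (norm a + K)" if u: "norm u = 1" for u
  proof -
    have "\<bar>u \<bullet> a + r u\<bar> \<le> norm a + K"
      using ua[OF u] r[OF u] by linarith
    then have "n * \<bar>u \<bullet> a + r u\<bar> * \<bar>u \<bullet> e\<bar> \<le> n * (norm a + K) * 1"
      using n K ue[OF u] by (intro mult_mono) auto
    then show ?thesis using n by (simp add: X abs_mult)
  qed
  then show "\<bar>X u\<bar> \<le> n * (norm (gradf x) + L * \<Delta> / 2)" if "norm u = 1" for u
    using that by (simp add: a_def K_def)
  note int = integrable_uniform_sphere_bounded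
  note intm = integrable_uniform_sphere_inner_mult
  have int2: "integrable uniform_sphere (\<lambda>u::real^'n. (u \<bullet> b)\<^sup>2)" for b
    unfolding power2_eq_square by (rule intm)
  have int_e: "integrable uniform_sphere (\<lambda>u. u \<bullet> e)"
    by (rule int[where B = 1]) (auto intro: ue)
  have int_abs: "integrable uniform_sphere (\<lambda>u. \<bar>u \<bullet> e\<bar>)"
    using int_e by (rule integrable_abs)
  have int_r: "integrable uniform_sphere (\<lambda>u. (r u - K / 2) * (u \<bullet> e))"
  proof (rule int[where B = "K / 2"])
    fix u :: "real ^ 'n" assume u: "norm u = 1"
    have "\<bar>r u - K / 2\<bar> \<le> K / 2" using r[OF u] by linarith
    then have "\<bar>r u - K / 2\<bar> * \<bar>u \<bullet> e\<bar> \<le> K / 2 * 1"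
      using ue[OF u] K by (intro mult_mono) auto
    then show "\<bar>(r u - K / 2) * (u \<bullet> e)\<bar> \<le> K / 2" by (simp add: abs_mult)
  qed simp
  have int_X2: "integrable uniform_sphere (\<lambda>u. (X u)\<^sup>2)"
    by (rule int[where B = "(n * (norm a + K))\<^sup>2"])
       (use bound Xm in \<open>auto simp: abs_le_square_iff[symmetric] n_def K add_nonneg_nonneg\<close>)
  have "(\<integral>u. X u \<partial>uniform_sphere) =
      (\<integral>u. n * ((u \<bullet> a) * (u \<bullet> e)) + n * ((r u - K / 2) * (u \<bullet> e)) + n * (K / 2) * (u \<bullet> e) \<partial>uniform_sphere)"
    by (intro Bochner_Integration.integral_cong[OF refl]) (simp add: X algebra_simps)
  also have "\<dots> = n * (\<integral>u. (u \<bullet> a) * (u \<bullet> e) \<partial>uniform_sphere)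
      + n * (\<integral>u. (r u - K / 2) * (u \<bullet> e) \<partial>uniform_sphere)
      + n * (K / 2) * (\<integral>u. u \<bullet> e \<partial>uniform_sphere)"
    using intm[of a e] int_r int_e by simp
  also have "\<dots> = a \<bullet> e + n * (\<integral>u. (r u - K / 2) * (u \<bullet> e) \<partial>uniform_sphere)"
    by (simp add: integral_uniform_sphere_inner integral_uniform_sphere_inner_mult n_def)
  also have "(\<integral>u. (r u - K / 2) * (u \<bullet> e) \<partial>uniform_sphere) \<le> (\<integral>u. K / 2 * \<bar>u \<bullet> e\<bar> \<partial>uniform_sphere)"
  proof (rule integral_mono_AE)
    show "AE u in uniform_sphere. (r u - K / 2) * (u \<bullet> e) \<le> K / 2 * \<bar>u \<bullet> e\<bar>"
      using AE_uniform_sphere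
    proof eventually_elim
      case (elim u)
      have "\<bar>r u - K / 2\<bar> \<le> K / 2" using r[OF elim] by linarith
      then have "\<bar>r u - K / 2\<bar> * \<bar>u \<bullet> e\<bar> \<le> K / 2 * \<bar>u \<bullet> e\<bar>"
        by (intro mult_right_mono) auto
      then show ?case
        by (metis abs_mult abs_le_D1)
    qed
  qed (use int_r int_abs in auto)
  also have "(\<integral>u. K / 2 * \<bar>u \<bullet> e\<bar> \<partial>uniform_sphere) \<le> K / 2 * (1 / sqrt n)"
    using mult_left_mono[OF integral_uniform_sphere_abs_inner_le[of e], of "K / 2"] K e
    by (simp add: n_def)
  also have "n * (K / 2 * (1 / sqrt n)) = sqrt n * (L * \<Delta>) / 4"
    using n by (simp add: K_def field_simps)
  finally show "(\<integral>u. X u \<partial>uniform_sphere) \<le> gradf x \<bullet> e + sqrt n * (L * \<Delta>) / 4"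
    using n by (simp add: a_def)
  have "(\<integral>u. (X u)\<^sup>2 \<partial>uniform_sphere)
      \<le> (\<integral>u. n\<^sup>2 * (3 / 2) * (u \<bullet> a)\<^sup>2 + n\<^sup>2 * (3 * K\<^sup>2) * (u \<bullet> e)\<^sup>2 \<partial>uniform_sphere)"
  proof (rule integral_mono_AE)
    show "AE u in uniform_sphere. (X u)\<^sup>2 \<le> n\<^sup>2 * (3 / 2) * (u \<bullet> a)\<^sup>2 + n\<^sup>2 * (3 * K\<^sup>2) * (u \<bullet> e)\<^sup>2"
      using AE_uniform_sphere
    proof eventually_elim
      case (elim u)
      \<comment> \<open>The square is split unevenly: with \<open>(p + q)\<^sup>2 \<le> 2 * p\<^sup>2 + 2 * q\<^sup>2\<close>, the gradient term would be
        too large for the prescribed sample size when \<open>n\<close> is large and \<open>\<theta>\<close> is close to \<open>1 / 2\<close>.\<close>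
      have "(u \<bullet> a + r u)\<^sup>2 \<le> 3 / 2 * (u \<bullet> a)\<^sup>2 + 3 * (r u)\<^sup>2"
        using zero_le_power2[of "u \<bullet> a - 2 * r u"] by (simp add: power2_eq_square algebra_simps)
      also have "\<dots> \<le> 3 / 2 * (u \<bullet> a)\<^sup>2 + 3 * K\<^sup>2"
        using r[OF elim] by (simp add: power_mono)
      finally have "(u \<bullet> a + r u)\<^sup>2 * (u \<bullet> e)\<^sup>2 \<le> (3 / 2 * (u \<bullet> a)\<^sup>2 + 3 * K\<^sup>2) * (u \<bullet> e)\<^sup>2"
        by (rule mult_right_mono) simp
      moreover have "3 / 2 * (u \<bullet> a)\<^sup>2 * (u \<bullet> e)\<^sup>2 \<le> 3 / 2 * (u \<bullet> a)\<^sup>2 * 1"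
        using ue[OF elim] by (intro mult_left_mono) (auto simp: abs_square_le_1)
      ultimately have "(u \<bullet> a + r u)\<^sup>2 * (u \<bullet> e)\<^sup>2 \<le> 3 / 2 * (u \<bullet> a)\<^sup>2 + 3 * K\<^sup>2 * (u \<bullet> e)\<^sup>2"
        by (simp add: distrib_right)
      from mult_left_mono[OF this, of "n\<^sup>2"]
      have "n\<^sup>2 * ((u \<bullet> a + r u)\<^sup>2 * (u \<bullet> e)\<^sup>2)
          \<le> n\<^sup>2 * (3 / 2) * (u \<bullet> a)\<^sup>2 + n\<^sup>2 * (3 * K\<^sup>2) * (u \<bullet> e)\<^sup>2"
        by (simp add: distrib_left mult.assoc)
      then show ?case
        by (simp add: X power_mult_distrib mult.assoc)
    qed
  qed (use int_X2 int2 in auto)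
  also have "\<dots> = n\<^sup>2 * (3 / 2) * (\<integral>u. (u \<bullet> a)\<^sup>2 \<partial>uniform_sphere)
      + n\<^sup>2 * (3 * K\<^sup>2) * (\<integral>u. (u \<bullet> e)\<^sup>2 \<partial>uniform_sphere)"
    using int2[of a] int2[of e] by simp
  also have "\<dots> = n * (3 / 2 * (norm (gradf x))\<^sup>2 + 3 / 4 * (L * \<Delta>)\<^sup>2)"
    unfolding integral_uniform_sphere_inner_power2 n_def[symmetric] e
    using n by (simp add: a_def K_def field_simps power2_eq_square)
  finally show "(\<integral>u. (X u)\<^sup>2 \<partial>uniform_sphere) \<le> n * (3 / 2 * (norm (gradf x))\<^sup>2 + 3 / 4 * (L * \<Delta>)\<^sup>2)" .
qed

lemma (in prob_space) spherical_samples_tail: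
  fixes f :: "real ^ 'n \<Rightarrow> real" and gradf :: "real ^ 'n \<Rightarrow> real ^ 'n"
    and x e :: "real ^ 'n" and \<Delta> L \<mu> n :: real
    and U :: "'i \<Rightarrow> 'a \<Rightarrow> real ^ 'n"
  defines "n \<equiv> real CARD('n)"
  assumes grad: "\<And>z. GDERIV f z :> gradf z"
    and lip: "L-lipschitz_on UNIV gradf" "0 < L"
    and sc: "strongly_convex \<mu> f" "0 \<le> \<mu>"
    and e: "norm e = 1"
    and \<Delta>: "0 < \<Delta>"
    and fin: "finite I"
    and indep: "indep_vars (\<lambda>_. borel) U I"
    and unif: "\<And>i. i \<in> I \<Longrightarrow> distr M borel (U i) = uniform_sphere"
    and t: "0 < t"
  shows "prob {\<omega> \<in> space M. (\<Sum>i\<in>I. n * ((f (x + \<Delta> *\<^sub>R U i \<omega>) - f x) / \<Delta>) * (U i \<omega> \<bullet> e))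
        \<ge> real (card I) * (gradf x \<bullet> e + sqrt n * (L * \<Delta>) / 4 + t)}
    \<le> exp (- (real (card I) * t\<^sup>2 / (2 * (n * (3 / 2 * (norm (gradf x))\<^sup>2 + 3 / 4 * (L * \<Delta>)\<^sup>2)
        + n * (norm (gradf x) + L * \<Delta> / 2) * t / 3))))"
proof -
  let ?X = "\<lambda>u. n * ((f (x + \<Delta> *\<^sub>R u) - f x) / \<Delta>) * (u \<bullet> e)"
  note mom = spherical_sample_moments[OF grad lip(1) sc e \<Delta>, where x = x, folded n_def]
  have n: "n > 0" by (simp add: n_def)
  have rv: "random_variable borel (U i)" if "i \<in> I" for i
    using indep that by (auto simp: indep_vars_def)
  have distr: "expectation (\<lambda>\<omega>. \<phi> (U i \<omega>)) = (\<integral>u. \<phi> u \<partial>uniform_sphere)"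
    if "i \<in> I" "\<phi> \<in> borel_measurable borel" for i and \<phi> :: "real ^ 'n \<Rightarrow> real"
    using integral_distr[OF rv[OF that(1)] that(2)] unif[OF that(1)] by simp
  have unit: "AE \<omega> in M. norm (U i \<omega>) = 1" if "i \<in> I" for i
  proof -
    have "AE u in distr M borel (U i). norm u = 1"
      unfolding unif[OF that] by (rule AE_uniform_sphere)
    then show ?thesis
      by (subst (asm) AE_distr_iff[OF rv[OF that]]) auto
  qed
  show ?thesis
  proof (rule Bernstein_ineq_sum_ge[OF fin])
    show "indep_vars (\<lambda>_. borel) (\<lambda>i \<omega>. ?X (U i \<omega>)) I"
      by (rule indep_vars_compose2[OF indep mom(1)])
    fix i assume i: "i \<in> I"
    show "AE \<omega> in M. \<bar>?X (U i \<omega>)\<bar> \<le> n * (norm (gradf x) + L * \<Delta> / 2)"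
      using unit[OF i] by eventually_elim (rule mom(2))
    show "expectation (\<lambda>\<omega>. ?X (U i \<omega>)) \<le> gradf x \<bullet> e + sqrt n * (L * \<Delta>) / 4"
      unfolding distr[OF i mom(1)] by (rule mom(3))
    have "(\<lambda>u. (?X u)\<^sup>2) \<in> borel_measurable borel"
      using mom(1) by simp
    from distr[OF i this] mom(4)
    show "expectation (\<lambda>\<omega>. (?X (U i \<omega>))\<^sup>2)
        \<le> n * (3 / 2 * (norm (gradf x))\<^sup>2 + 3 / 4 * (L * \<Delta>)\<^sup>2)" by simp
  next
    show "0 \<le> n * (norm (gradf x) + L * \<Delta> / 2)"
      using n lip(2) \<Delta> by simp
    show "0 < n * (3 / 2 * (norm (gradf x))\<^sup>2 + 3 / 4 * (L * \<Delta>)\<^sup>2)"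
      using n lip(2) \<Delta> by (intro mult_pos_pos add_nonneg_pos) auto
  qed (rule t)
qed

text \<open>
  The sample size that Bernstein's inequality asks for, divided by the logarithm of the inverse failure
  probability, is at most the prescribed bracket. Here \<open>t\<close> is the tolerance \<open>\<mu> * m / 2\<close> less the bias
  \<open>\<theta> * \<mu> * m / 4\<close>, and \<open>D\<close> stands for \<open>L * \<Delta>\<close>. The constant \<open>c' = 1 / 2 - \<theta> / 4\<close> takes the place of
  \<open>c = 1 / 2 - \<theta> / sqrt n\<close>. It is smaller than \<open>c\<close> when \<open>n > 16\<close>, but \<open>c \<le> 1 / 2\<close> and \<open>c' \<ge> 3 / 8\<close>
  always give \<open>c\<^sup>2 \<le> 2 * c'\<^sup>2\<close>, which the coefficients of the bracket can afford. Only the last of the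
  four terms is tight enough for \<open>n = 1\<close> to be treated apart; there \<open>c \<le> c'\<close>.
\<close>

lemma sample_size_constants:
  fixes n \<theta> \<mu> lam m G D t :: real
  assumes n: "n = 1 \<or> n \<ge> 2"
    and \<theta>: "0 < \<theta>" "\<theta> < 1 / 2"
    and lam: "0 < lam" "lam < 1"
    and pos: "0 < \<mu>" "0 < m" "0 \<le> G"
    and D: "D = \<theta> * \<mu> * m / sqrt n"
    and t: "t = \<mu> * m * (1 / 2 - \<theta> / 4)"
  shows "2 * (n * (3 / 2 * G\<^sup>2 + 3 / 4 * D\<^sup>2) + n * (G + D / 2) * t / 3) / t\<^sup>2
    \<le> 6 * n / (\<mu>\<^sup>2 * (1 - lam)\<^sup>2 * (1 / 2 - \<theta> / sqrt n)\<^sup>2) * (G / m)\<^sup>2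
         + 4 * n / (3 * \<mu> * (1 - lam) * (1 / 2 - \<theta> / sqrt n)) * (G / m)
         + 2 * \<theta> * sqrt n / (3 * (1 - lam) * (1 / 2 - \<theta> / sqrt n)\<^sup>2)
         + 3 * \<theta>\<^sup>2 * n / (2 * (1 - lam)\<^sup>2 * (1 / 2 - \<theta> / sqrt n)\<^sup>2)"
proof -
  define c where "c = 1 / 2 - \<theta> / sqrt n"
  define c' where "c' = 1 / 2 - \<theta> / 4"
  define \<kappa> where "\<kappa> = 1 - lam"
  have n1: "n \<ge> 1" using n by auto
  have "\<theta> / sqrt n \<le> \<theta>" using n1 \<theta> by (simp add: field_simps)
  then have c: "0 < c" using \<theta> unfolding c_def by linarith
  have c2: "c \<le> 1 / 2" using \<theta> n1 by (simp add: c_def)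
  have c': "3 / 8 \<le> c'" using \<theta> by (simp add: c'_def)
  have \<kappa>: "0 < \<kappa>" "\<kappa> \<le> 1" using lam by (auto simp: \<kappa>_def)
  have \<kappa>2: "\<kappa>\<^sup>2 \<le> 1" using \<kappa> by (simp add: power_le_one)
  have csq: "c\<^sup>2 \<le> 1 / 4" using power_mono[OF c2, of 2] c by (simp add: power2_eq_square)
  have c'sq: "9 / 64 \<le> c'\<^sup>2" using power_mono[OF c', of 2] by (simp add: power2_eq_square)
  have cn: "c\<^sup>2 \<le> n * c'\<^sup>2"
  proof (cases "n = 1")
    case True
    then have "c \<le> c'" using \<theta> by (simp add: c_def c'_def)
    then show ?thesis using True c by (simp add: power_mono)
  next
    case False
    then have "2 * c'\<^sup>2 \<le> n * c'\<^sup>2" using n by (intro mult_right_mono) auto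
    then show ?thesis using csq c'sq by linarith
  qed
  have k1: "\<kappa> * c \<le> c" "\<kappa>\<^sup>2 * c\<^sup>2 \<le> c\<^sup>2" "\<kappa> * c\<^sup>2 \<le> c\<^sup>2"
    using \<kappa> \<kappa>2 c by (auto intro: mult_left_le_one_le)
  have T1: "3 * n * G\<^sup>2 / (\<mu>\<^sup>2 * m\<^sup>2 * c'\<^sup>2) \<le> 6 * n / (\<mu>\<^sup>2 * \<kappa>\<^sup>2 * c\<^sup>2) * (G / m)\<^sup>2"
  proof -
    have "\<kappa>\<^sup>2 * c\<^sup>2 \<le> 2 * c'\<^sup>2" using k1 csq c'sq by linarith
    then have "3 / c'\<^sup>2 \<le> 6 / (\<kappa>\<^sup>2 * c\<^sup>2)"
      using c c' \<kappa> by (simp add: field_simps)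
    from mult_right_mono[OF this, of "n * G\<^sup>2 / (\<mu>\<^sup>2 * m\<^sup>2)"] show ?thesis
      using n1 by (simp add: power_divide field_simps)
  qed
  have T2: "2 * n * G / (3 * \<mu> * m * c') \<le> 4 * n / (3 * \<mu> * \<kappa> * c) * (G / m)"
  proof -
    have "\<kappa> * c \<le> 2 * c'" using k1 c2 c' by linarith
    then have "2 / c' \<le> 4 / (\<kappa> * c)"
      using c c' \<kappa> by (simp add: field_simps)
    from mult_right_mono[OF this, of "n * G / (3 * \<mu> * m)"] show ?thesis
      using n1 pos by (simp add: field_simps)
  qed
  have T3: "\<theta> * sqrt n / (3 * c') \<le> 2 * \<theta> * sqrt n / (3 * \<kappa> * c\<^sup>2)"
  proof -
    have "\<kappa> * c\<^sup>2 \<le> 2 * c'" using k1 csq c' by linarith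
    then have "1 / c' \<le> 2 / (\<kappa> * c\<^sup>2)"
      using c c' \<kappa> by (simp add: field_simps)
    from mult_right_mono[OF this, of "\<theta> * sqrt n / 3"] show ?thesis
      using n1 \<theta> by (simp add: field_simps)
  qed
  have T4: "3 * \<theta>\<^sup>2 / (2 * c'\<^sup>2) \<le> 3 * \<theta>\<^sup>2 * n / (2 * \<kappa>\<^sup>2 * c\<^sup>2)"
  proof -
    have "\<kappa>\<^sup>2 * c\<^sup>2 \<le> n * c'\<^sup>2" using k1 cn by linarith
    then have "1 / c'\<^sup>2 \<le> n / (\<kappa>\<^sup>2 * c\<^sup>2)"
      using c c' \<kappa> by (simp add: field_simps)
    from mult_right_mono[OF this, of "3 * \<theta>\<^sup>2 / 2"] show ?thesis
      using n1 by (simp add: field_simps)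
  qed
  have D2: "n * D\<^sup>2 = \<theta>\<^sup>2 * \<mu>\<^sup>2 * m\<^sup>2"
    using n1 by (simp add: D power_divide power_mult_distrib)
  have nD: "n * D = \<theta> * \<mu> * m * sqrt n"
    using n1 by (simp add: D field_simps)
  have tt: "t = \<mu> * m * c'" by (simp add: t c'_def)
  have t0: "t > 0" using pos c' by (simp add: tt)
  have "2 * (n * (3 / 2 * G\<^sup>2 + 3 / 4 * D\<^sup>2) + n * (G + D / 2) * t / 3) / t\<^sup>2
      = 3 * n * G\<^sup>2 / t\<^sup>2 + 3 / 2 * (n * D\<^sup>2) / t\<^sup>2 + 2 * n * G / (3 * t) + (n * D) / (3 * t)"
    using t0 by (simp add: field_simps power2_eq_square)
  also have "\<dots> = 3 * n * G\<^sup>2 / (\<mu>\<^sup>2 * m\<^sup>2 * c'\<^sup>2) + 3 * \<theta>\<^sup>2 / (2 * c'\<^sup>2)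
      + 2 * n * G / (3 * \<mu> * m * c') + \<theta> * sqrt n / (3 * c')"
    unfolding D2 nD tt using pos c' by (simp add: power_mult_distrib mult.assoc)
  also have "\<dots> \<le> 6 * n / (\<mu>\<^sup>2 * \<kappa>\<^sup>2 * c\<^sup>2) * (G / m)\<^sup>2 + 4 * n / (3 * \<mu> * \<kappa> * c) * (G / m)
      + 2 * \<theta> * sqrt n / (3 * \<kappa> * c\<^sup>2) + 3 * \<theta>\<^sup>2 * n / (2 * \<kappa>\<^sup>2 * c\<^sup>2)"
    using T1 T2 T3 T4 by linarith
  finally show ?thesis unfolding c_def \<kappa>_def .
qed

section \<open>Positive curvature along the previous step\<close>

theorem theorem6p5:
  fixes f :: "real ^ 'n \<Rightarrow> real"
    and gradf :: "real ^ 'n \<Rightarrow> real ^ 'n"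
    and h :: "real ^ 'n \<Rightarrow> ereal"
    and L\<^sub>f \<mu> \<theta> lam \<nu> n :: real
    and x s :: "nat \<Rightarrow> real ^ 'n"
    and \<Delta> :: "nat \<Rightarrow> real"
    and N :: "nat \<Rightarrow> nat"
    and M :: "'w measure"
    and u :: "nat \<Rightarrow> nat \<Rightarrow> 'w \<Rightarrow> real ^ 'n"
    and g :: "nat \<Rightarrow> 'w \<Rightarrow> real ^ 'n"
  defines "n \<equiv> real CARD('n)"
    and "s \<equiv> \<lambda>k. x (Suc k) - x k"
    and "g \<equiv> \<lambda>k \<omega>. spherical_smoothing f (x k) (\<Delta> k) (N k) (\<lambda>i. u k i \<omega>)"
  assumes grad: "\<And>z. GDERIV f z :> gradf z"
    and grad_cont: "continuous_on UNIV gradf"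
    and L_pos: "L\<^sub>f > 0"
    and grad_lipschitz: "L\<^sub>f-lipschitz_on UNIV gradf"
    and h_proper: "proper_fun h"
    and h_closed: "closed_fun h"
    and h_convex: "convex_fun h"
    and F_bounded_below: "bounded_below_fun (\<lambda>z. ereal (f z) + h z)"
    and \<mu>_pos: "\<mu> > 0"
    and f_strongly_convex: "strongly_convex \<mu> f"
    and \<theta>: "0 < \<theta>" "\<theta> < 1 / 2"
    and lam: "0 < lam" "lam < 1"
    and \<nu>: "0 < \<nu>" "\<nu> < 1"
    and s_nonzero: "\<And>k. s k \<noteq> 0"
    and M: "prob_space M"
    and u_indep: "prob_space.indep_vars M (\<lambda>_. borel) (\<lambda>(k, i). u k i) (SIGMA k:UNIV. {1..N k})"
    and u_uniform: "\<And>k i. i \<in> {1..N k} \<Longrightarrow> distr M borel (u k i) = uniform_sphere"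
    and N_pos: "\<And>k. N k > 0"
    and \<Delta>: "\<And>k. \<Delta> k = \<theta> * \<mu> / (sqrt n * L\<^sub>f) * min_step s k"
    and N: "\<And>k. real (N k) \<ge>
        (6 * n / (\<mu>\<^sup>2 * (1 - lam)\<^sup>2 * (1 / 2 - \<theta> / sqrt n)\<^sup>2) * (norm (gradf (x k)) / min_step s k)\<^sup>2
         + 4 * n / (3 * \<mu> * (1 - lam) * (1 / 2 - \<theta> / sqrt n)) * (norm (gradf (x k)) / min_step s k)
         + 2 * \<theta> * sqrt n / (3 * (1 - lam) * (1 / 2 - \<theta> / sqrt n)\<^sup>2)
         + 3 * \<theta>\<^sup>2 * n / (2 * (1 - lam)\<^sup>2 * (1 / 2 - \<theta> / sqrt n)\<^sup>2))
        * ln ((n + 1) / \<nu>)"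
  shows "\<forall>k\<ge>1. measure M {\<omega> \<in> space M. (g k \<omega> - g (k - 1) \<omega>) \<bullet> s (k - 1) > 0} \<ge> 1 - \<nu>"
proof -
  interpret prob_space M by (rule M)
  have n: "n = 1 \<or> n \<ge> 2" "n \<ge> 1"
  proof -
    have "CARD('n) \<ge> 1" using zero_less_card_finite[where 'a='n] by linarith
    then have "CARD('n) = 1 \<or> CARD('n) \<ge> 2" by linarith
    then show "n = 1 \<or> n \<ge> 2" unfolding n_def by auto
    then show "n \<ge> 1" by auto
  qed
  have m: "0 < min_step s j" for j
    using s_nonzero by (simp add: min_step_def)
  have \<Delta>_pos: "0 < \<Delta> j" for j
    unfolding \<Delta> using \<theta> \<mu>_pos L_pos n m[of j] by simp
  have rv: "u k i \<in> borel_measurable M" if "i \<in> {1..N k}" for k i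
    using u_indep that unfolding indep_vars_def by force
  have [measurable]: "f \<in> borel_measurable borel"
    by (rule borel_measurable_GDERIV[OF grad])
  have g_inner: "g j \<omega> \<bullet> e = (\<Sum>i = 1..N j.
      n * ((f (x j + \<Delta> j *\<^sub>R u j i \<omega>) - f (x j)) / \<Delta> j) * (u j i \<omega> \<bullet> e)) / real (N j)"
    for j \<omega> e
    by (simp add: g_def spherical_smoothing_def n_def inner_sum_left sum_distrib_left sum_divide_distrib
        mult_ac)
  have g_measurable [measurable]: "(\<lambda>\<omega>. g j \<omega> \<bullet> e) \<in> borel_measurable M" for j e
    unfolding g_inner
    by (intro borel_measurable_divide borel_measurable_sum borel_measurable_const)
       (use rv in measurable)
  have tail: "prob {\<omega> \<in> space M. g j \<omega> \<bullet> e \<ge> gradf (x j) \<bullet> e + \<mu> * min_step s j / 2} \<le> \<nu> / (n + 1)"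
    if e: "norm e = 1" for j e
  proof -
    define D where "D = L\<^sub>f * \<Delta> j"
    define t where "t = \<mu> * min_step s j * (1 / 2 - \<theta> / 4)"
    define V where "V = n * (3 / 2 * (norm (gradf (x j)))\<^sup>2 + 3 / 4 * D\<^sup>2)
        + n * (norm (gradf (x j)) + D / 2) * t / 3"
    \<comment> \<open>The directions are kept under their joint index \<open>(k, i)\<close>, the one under which they are independent.\<close>
    let ?I = "{j} \<times> {1..N j}"
    have D: "D = \<theta> * \<mu> * min_step s j / sqrt n"
      using L_pos by (simp add: D_def \<Delta>)
    have D_pos: "D > 0" using L_pos \<Delta>_pos by (simp add: D_def)
    have t: "t > 0" using \<theta> \<mu>_pos m[of j] by (simp add: t_def)
    have V: "V > 0"
      unfolding V_def using n D_pos t by (intro add_pos_nonneg mult_pos_pos add_nonneg_pos) auto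
    have shift: "sqrt n * D / 4 + t = \<mu> * min_step s j / 2"
      using n by (simp add: D t_def algebra_simps)
    have indep: "indep_vars (\<lambda>_. borel) (\<lambda>(k, i). u k i) ?I"
      by (rule indep_vars_subset[OF u_indep]) auto
    have sum: "(\<Sum>p\<in>?I. n * ((f (x j + \<Delta> j *\<^sub>R (case p of (k, i) \<Rightarrow> u k i) \<omega>) - f (x j)) / \<Delta> j)
          * ((case p of (k, i) \<Rightarrow> u k i) \<omega> \<bullet> e)) = real (N j) * (g j \<omega> \<bullet> e)" for \<omega>
    proof -
      have I: "?I = Pair j ` {1..N j}" by auto
      show ?thesis
        unfolding g_inner I using N_pos[of j] by (subst sum.reindex) (auto simp: inj_on_def)
    qed
    have "prob {\<omega> \<in> space M. g j \<omega> \<bullet> e \<ge> gradf (x j) \<bullet> e + \<mu> * min_step s j / 2}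
        \<le> exp (- (real (N j) * t\<^sup>2 / (2 * V)))"
      using spherical_samples_tail[OF grad grad_lipschitz L_pos f_strongly_convex _ e \<Delta>_pos[of j] _
          indep _ t, of "x j"] \<mu>_pos u_uniform N_pos[of j]
      unfolding n_def[symmetric] sum D_def[symmetric] add.assoc shift V_def[symmetric]
      by (auto simp: case_prod_beta)
    also have "real (N j) * t\<^sup>2 / (2 * V) \<ge> ln ((n + 1) / \<nu>)"
    proof -
      have "0 \<le> ln ((n + 1) / \<nu>)" using n \<nu> by simp
      from mult_right_mono[OF sample_size_constants[OF n(1) \<theta> lam \<mu>_pos m[of j] norm_ge_zero[of "gradf (x j)"]
            D t_def] this]
      have "2 * V / t\<^sup>2 * ln ((n + 1) / \<nu>) \<le> real (N j)"
        unfolding V_def[symmetric] using N[of j] by (rule order_trans)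
      then show ?thesis using V t by (simp add: field_simps)
    qed
    then have "exp (- (real (N j) * t\<^sup>2 / (2 * V))) \<le> exp (- ln ((n + 1) / \<nu>))"
      by simp
    also have "\<dots> = \<nu> / (n + 1)"
      using n \<nu> by (simp add: exp_minus)
    finally show ?thesis .
  qed
  show ?thesis
  proof (intro allI impI)
    fix k :: nat assume k: "k \<ge> 1"
    define w where "w = s (k - 1)"
    define e where "e = w /\<^sub>R norm w"
    have w: "norm w > 0" using s_nonzero by (simp add: w_def)
    have e: "norm e = 1" "norm (- e) = 1" using w by (simp_all add: e_def)
    have we: "w = norm w *\<^sub>R e" using w by (simp add: e_def)
    have m_le: "min_step s k \<le> norm w" "min_step s (k - 1) \<le> norm w"
      using k by (auto simp: min_step_def w_def)
    have mono: "\<mu> * norm w \<le> (gradf (x k) - gradf (x (k - 1))) \<bullet> e"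
    proof -
      have "w = x k - x (k - 1)" using k by (simp add: w_def s_def)
      then have "\<mu> * (norm w)\<^sup>2 \<le> (gradf (x k) - gradf (x (k - 1))) \<bullet> w"
        using strongly_convex_gradient_monotone[OF grad f_strongly_convex, of "x k" "x (k - 1)"] by simp
      also have "\<dots> = norm w * ((gradf (x k) - gradf (x (k - 1))) \<bullet> e)"
        by (subst we) simp
      finally show ?thesis using w by (simp add: power2_eq_square)
    qed
    \<comment> \<open>The two bad events: the estimate at \<open>x k\<close> is too small, or the one at \<open>x (k - 1)\<close> too large, in
      the direction \<open>e\<close>.\<close>
    let ?A = "{\<omega> \<in> space M. g k \<omega> \<bullet> (- e) \<ge> gradf (x k) \<bullet> (- e) + \<mu> * min_step s k / 2}"
    let ?B = "{\<omega> \<in> space M. g (k - 1) \<omega> \<bullet> e \<ge> gradf (x (k - 1)) \<bullet> e + \<mu> * min_step s (k - 1) / 2}"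
    let ?G = "{\<omega> \<in> space M. (g k \<omega> - g (k - 1) \<omega>) \<bullet> s (k - 1) > 0}"
    have ev: "?A \<in> events" "?B \<in> events" by measurable
    have G: "?G \<in> events" unfolding inner_diff_left by measurable
    have "prob (?A \<union> ?B) \<le> \<nu> / (n + 1) + \<nu> / (n + 1)"
      using measure_Un_le[OF ev] tail[OF e(2), of k] tail[OF e(1), of "k - 1"] by linarith
    also have "\<dots> \<le> \<nu>"
    proof -
      \<comment> \<open>\<open>n + 1 \<ge> 2\<close> pays for the union of two events.\<close>
      have "\<nu> / (n + 1) \<le> \<nu> / 2" using n \<nu> by (intro divide_left_mono) auto
      then show ?thesis by linarith
    qed
    finally have "1 - \<nu> \<le> prob (space M - (?A \<union> ?B))"
      using prob_compl[of "?A \<union> ?B"] ev by auto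
    also have "\<dots> \<le> prob ?G"
    proof (rule finite_measure_mono[OF _ G], rule subsetI)
      fix \<omega> assume "\<omega> \<in> space M - (?A \<union> ?B)"
      then have \<omega>: "\<omega> \<in> space M"
        and "g k \<omega> \<bullet> e > gradf (x k) \<bullet> e - \<mu> * min_step s k / 2"
        and "g (k - 1) \<omega> \<bullet> e < gradf (x (k - 1)) \<bullet> e + \<mu> * min_step s (k - 1) / 2"
        by auto
      moreover have "\<mu> * min_step s k \<le> \<mu> * norm w" "\<mu> * min_step s (k - 1) \<le> \<mu> * norm w"
        using m_le \<mu>_pos by auto
      ultimately have "(g k \<omega> - g (k - 1) \<omega>) \<bullet> e > 0"
        using mono unfolding inner_diff_left by linarith
      then have "(g k \<omega> - g (k - 1) \<omega>) \<bullet> w > 0"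
        using w by (subst we) simp
      with \<omega> show "\<omega> \<in> ?G" by (simp add: w_def)
    qed
    finally show "1 - \<nu> \<le> prob ?G" .
  qed
qed

end
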